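(* Let $n\ge1$ and let $D_{2n}$ be the dihedral group of order $2n$ generated by $a,b$ with relations $a^n=b^2=e$, $bab^{-1}=a^{-1}$. Let $\eta$ be a primitive $n$-th root of unity in $\mathbb{C}$. For each integer $k$ define $\tau_k'\in\mathrm{Map}(D_{2n},\mathbb{C})$ by $\tau_k'(a^i)=\eta^{ik}+\eta^{-ik}$ and $\tau_k'(ba^i)=0$ for $i=0,1,\dots,n-1$. Let $\chi_1$ be the trivial character, and let $\chi_2$ be the one-dimensional character with $\chi_2(a^i)=1$, $\chi_2(ba^i)=-1$ for all $i$. Then for every integer $k$: (1) $\lambda^2(\tau_k')=\chi_2$. (2) For every integer $m\ge1$, $\displaystyle S^{2m-1}(\tau_k')=\sum_{i=1}^m\tau'_{(2i-1)k}$ and $\displaystyle S^{2m}(\tau_k')=\sum_{i=1}^m\tau'_{2ik}+\chi_1$.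
   Context: For a finite group $G$, $\mathrm{Map}(G,\mathbb{C})$ is the commutative $\mathbb{C}$-algebra of all functions $G\to\mathbb{C}$ with pointwise operations. Adams operations: $\psi^n(f)(g)=f(g^n)$ for $n\ge1$. The $\lambda$-operations $\lambda^i$ ($i\ge 0$) on $\mathrm{Map}(G,\mathbb{C})$ are defined by letting $\lambda_t(f)=\sum_{i\ge0}\lambda^i(f)t^i$ be the unique formal power series over $\mathrm{Map}(G,\mathbb{C})$ with constant term $1$ satisfying $\sum_{n\ge1}\psi^n(f)(-t)^n=-t\,\bigl(\tfrac{d}{dt}\lambda_t(f)\bigr)\lambda_t(f)^{-1}$. The symmetric power operations $S^i$ are defined by $S_t(f)=\sum_{i\ge0}S^i(f)t^i=(\lambda_{-t}(f))^{-1}$. (If $\chi$ is the character of a finite-dimensional complex representation $V$, then $\lambda^i(\chi)$ and $S^i(\chi)$ are the characters of $\bigwedge^i V$ and $S^i(V)$.) *)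

theory Defs
  imports
    Complex_Main
    "HOL-Algebra.Generated_Groups"
    "HOL-Library.Function_Division"
    "HOL-Computational_Algebra.Formal_Power_Series"
begin

(* The relations alone only say that G is a quotient of the dihedral group; the order makes it
   the dihedral group itself.  For n = 1 the rotation a is trivial. *)
locale dihedral_group = group G for G (structure) +
  fixes n :: nat and a b :: 'a
  assumes a_closed: "a \<in> carrier G" and b_closed: "b \<in> carrier G"
    and generated: "carrier G = generate G {a, b}"
    and order_eq: "order G = 2 * n"
    and a_pow: "a [^] n = \<one>"
    and b_pow: "b [^] (2::nat) = \<one>"
    and conj: "b \<otimes> a \<otimes> inv b = inv a"

definition primitive_root_unity :: "nat \<Rightarrow> complex \<Rightarrow> bool" where
  "primitive_root_unity n z \<longleftrightarrow> n > 0 \<and> z ^ n = 1 \<and> (\<forall>m. 0 < m \<and> m < n \<longrightarrow> z ^ m \<noteq> 1)"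

(* A complex function on the group G is represented by a function on the whole underlying type,
   and two such functions represent the same element of Map(G, C) iff they agree on carrier G.
   The ring structure on them, and hence that of their power series, is the pointwise one of
   Function_Algebras. Restriction to carrier G is a surjective ring homomorphism onto Map(G, C)
   that commutes with all the operations below (see lambda_op_cong and sym_op_cong). *)

definition adams :: "('g, 'm) monoid_scheme \<Rightarrow> nat \<Rightarrow> ('g \<Rightarrow> complex) \<Rightarrow> ('g \<Rightarrow> complex)" where
  "adams G n f = (\<lambda>g. f (g [^]\<^bsub>G\<^esub> n))"

(* The sum of psi^n(f) (-t)^n over n >= 1. *)
definition adams_series :: "('g, 'm) monoid_scheme \<Rightarrow> ('g \<Rightarrow> complex) \<Rightarrow> ('g \<Rightarrow> complex) fps" where
  "adams_series G f = Abs_fps (\<lambda>n. if n = 0 then 0 else (- 1) ^ n * adams G n f)"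

definition lambda_series :: "('g, 'm) monoid_scheme \<Rightarrow> ('g \<Rightarrow> complex) \<Rightarrow> ('g \<Rightarrow> complex) fps" where
  "lambda_series G f =
     (THE L. fps_nth L 0 = 1 \<and> adams_series G f = - fps_X * fps_deriv L * inverse L)"

definition lambda_op :: "('g, 'm) monoid_scheme \<Rightarrow> nat \<Rightarrow> ('g \<Rightarrow> complex) \<Rightarrow> ('g \<Rightarrow> complex)" where
  "lambda_op G i f = fps_nth (lambda_series G f) i"

definition sym_series :: "('g, 'm) monoid_scheme \<Rightarrow> ('g \<Rightarrow> complex) \<Rightarrow> ('g \<Rightarrow> complex) fps" where
  "sym_series G f = inverse (fps_compose (lambda_series G f) (- fps_X))"

definition sym_op :: "('g, 'm) monoid_scheme \<Rightarrow> nat \<Rightarrow> ('g \<Rightarrow> complex) \<Rightarrow> ('g \<Rightarrow> complex)" where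
  "sym_op G i f = fps_nth (sym_series G f) i"

lemma fps_fun_inverse:
  fixes L :: "('g \<Rightarrow> complex) fps"
  assumes "fps_nth L 0 = 1"
  shows "L * inverse L = 1"
proof -
  have "fps_nth L 0 * inverse (fps_nth L 0) = 1" using assms by (simp add: fun_eq_iff)
  from fps_right_inverse[OF this] show ?thesis by (simp only: fps_inverse_def)
qed

lemma lambda_eq_iff:
  fixes L :: "('g \<Rightarrow> complex) fps"
  assumes L0: "fps_nth L 0 = 1" and P0: "fps_nth P 0 = 0"
  shows "P = - fps_X * fps_deriv L * inverse L \<longleftrightarrow>
    (\<forall>n g. fps_nth L (Suc n) g =
      - (\<Sum>i\<le>n. fps_nth P (Suc i) g * fps_nth L (n - i) g) / of_nat (Suc n))"
    (is "?l \<longleftrightarrow> ?r")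
proof -
  have inv: "L * inverse L = 1" by (rule fps_fun_inverse[OF L0])
  have "?l \<longleftrightarrow> P * L = - fps_X * fps_deriv L"
  proof
    assume ?l
    then have "P * L = - fps_X * fps_deriv L * (L * inverse L)" by (simp add: mult_ac)
    then show "P * L = - fps_X * fps_deriv L" using inv by simp
  next
    assume "P * L = - fps_X * fps_deriv L"
    then have "P * (L * inverse L) = - fps_X * fps_deriv L * inverse L" by (metis mult.assoc)
    then show ?l using inv by simp
  qed
  also have "\<dots> \<longleftrightarrow> (\<forall>n. fps_nth (P * L) (Suc n) = fps_nth (- fps_X * fps_deriv L) (Suc n))"
  proof -
    have "fps_nth (P * L) 0 = fps_nth (- fps_X * fps_deriv L) 0" using P0 by simp
    then show ?thesis unfolding fps_eq_iff by (metis not0_implies_Suc)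
  qed
  also have "\<dots> \<longleftrightarrow> ?r"
  proof -
    have A: "fps_nth (P * L) (Suc n) g = (\<Sum>i\<le>n. fps_nth P (Suc i) g * fps_nth L (n - i) g)" for n g
    proof -
      have "fps_nth (P * L) (Suc n) = (\<Sum>i\<le>n. fps_nth P (Suc i) * fps_nth L (n - i))"
        unfolding fps_mult_nth atLeast0AtMost by (subst sum.atMost_Suc_shift) (simp add: P0)
      moreover have "sum F I g = (\<Sum>i\<in>I. F i g)" for F :: "nat \<Rightarrow> 'g \<Rightarrow> complex" and I
        by (induction I rule: infinite_finite_induct) auto
      ultimately show ?thesis by simp
    qed
    have N: "(of_nat k :: 'g \<Rightarrow> complex) g = of_nat k" for k g by (induction k) auto
    have B: "fps_nth (- fps_X * fps_deriv L) (Suc n) g = - (of_nat (Suc n) * fps_nth L (Suc n) g)" for n g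
      using N[of "Suc n" g] by (simp del: of_nat_Suc)
    have "s = - (of_nat (Suc n) * l) \<longleftrightarrow> l = - s / of_nat (Suc n)" for s l :: complex and n
      by (auto simp del: of_nat_Suc)
    then show ?thesis by (simp only: fun_eq_iff A B)
  qed
  finally show ?thesis .
qed

fun lambda_rec :: "('g \<Rightarrow> complex) fps \<Rightarrow> nat \<Rightarrow> 'g \<Rightarrow> complex" where
  "lambda_rec P 0 g = 1"
| "lambda_rec P (Suc n) g = - (\<Sum>i\<le>n. fps_nth P (Suc i) g * lambda_rec P (n - i) g) / of_nat (Suc n)"

lemma lambda_series_char:
  "fps_nth L 0 = 1 \<and> adams_series G f = - fps_X * fps_deriv L * inverse L \<longleftrightarrow>
    L = Abs_fps (lambda_rec (adams_series G f))"
  (is "?A L \<longleftrightarrow> L = ?M")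
proof -
  let ?P = "adams_series G f"
  have P0: "fps_nth ?P 0 = 0" by (simp add: adams_series_def)
  have M0: "fps_nth ?M 0 = 1" by (simp add: fun_eq_iff)
  have "\<forall>n g. fps_nth ?M (Suc n) g =
      - (\<Sum>i\<le>n. fps_nth ?P (Suc i) g * fps_nth ?M (n - i) g) / of_nat (Suc n)"
    by (simp only: fps_nth_Abs_fps lambda_rec.simps) simp
  then have "?P = - fps_X * fps_deriv ?M * inverse ?M"
    using lambda_eq_iff[OF M0 P0] by blast
  with M0 have M: "?A ?M" by blast
  have "L = ?M" if "?A L"
  proof -
    from that have L0: "fps_nth L 0 = 1" and e: "?P = - fps_X * fps_deriv L * inverse L" by blast+
    have r: "\<forall>n g. fps_nth L (Suc n) g =
      - (\<Sum>i\<le>n. fps_nth ?P (Suc i) g * fps_nth L (n - i) g) / of_nat (Suc n)"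
      using lambda_eq_iff[OF L0 P0] e by blast
    have "fps_nth L n g = lambda_rec ?P n g" for n g
    proof (induction n rule: less_induct)
      case (less n)
      show ?case
      proof (cases n)
        case 0
        then show ?thesis using L0 by simp
      next
        case (Suc k)
        have "fps_nth L (k - i) g = lambda_rec ?P (k - i) g" for i
          using less Suc by simp
        then show ?thesis unfolding Suc using r by (simp del: of_nat_Suc)
      qed
    qed
    then have "fps_nth L n = fps_nth ?M n" for n by (simp add: fun_eq_iff)
    then show ?thesis by (rule fps_ext)
  qed
  with M show ?thesis by blast
qed

lemma lambda_series_ex1:
  "\<exists>!L. fps_nth L 0 = 1 \<and> adams_series G f = - fps_X * fps_deriv L * inverse L"
  by (simp only: lambda_series_char) simp

lemma lambda_op_eq: "lambda_op G i f g = lambda_rec (adams_series G f) i g"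
proof -
  have "lambda_series G f = Abs_fps (lambda_rec (adams_series G f))"
    unfolding lambda_series_def by (simp only: lambda_series_char) simp
  then show ?thesis by (simp add: lambda_op_def)
qed

lemma lambda_op_cong:
  assumes "group G" and eq: "\<And>g. g \<in> carrier G \<Longrightarrow> f g = h g" and g: "g \<in> carrier G"
  shows "lambda_op G i f g = lambda_op G i h g"
proof -
  interpret group G by fact
  have one: "(1 :: 'a \<Rightarrow> complex) x = 1" for x by simp
  have sgn: "((- 1) ^ n * F :: 'a \<Rightarrow> complex) x = (- 1) ^ n * F x" for n F x
    by (induction n) (simp_all add: mult.assoc)
  have P: "fps_nth (adams_series G f) n g = fps_nth (adams_series G h) n g" for n
    using g eq by (simp add: adams_series_def sgn adams_def del: times_fun_apply)
  have "lambda_rec (adams_series G f) i g = lambda_rec (adams_series G h) i g"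
  proof (induction i rule: less_induct)
    case (less i)
    show ?case
    proof (cases i)
      case (Suc k)
      have "lambda_rec (adams_series G f) (k - j) g = lambda_rec (adams_series G h) (k - j) g" for j
        using less Suc by simp
      then show ?thesis unfolding Suc by (simp add: P del: of_nat_Suc)
    qed simp
  qed
  then show ?thesis by (simp only: lambda_op_eq)
qed

lemma sym_op_cong:
  assumes "group G" and eq: "\<And>g. g \<in> carrier G \<Longrightarrow> f g = h g" and g: "g \<in> carrier G"
  shows "sym_op G i f g = sym_op G i h g"
proof -
  define C where "C u = fps_compose (lambda_series G u) (- fps_X)" for u
  have "C u = fps_compose (lambda_series G u) (fps_const (- 1) * fps_X)" for u
    by (simp add: C_def flip: fps_const_neg)
  then have Cn: "fps_nth (C u) n = (- 1) ^ n * lambda_op G n u" for u n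
    by (simp add: fps_compose_linear lambda_op_def)
  have sgn: "((- 1) ^ n * F :: 'a \<Rightarrow> complex) x = (- 1) ^ n * F x" for n F x
    by (induction n) (simp_all add: mult.assoc)
  have Cg: "fps_nth (C f) n g = fps_nth (C h) n g" for n
    unfolding Cn sgn using lambda_op_cong[OF assms(1) eq g] by simp
  have ap: "sum F I x = (\<Sum>i\<in>I. F i x)" for F :: "nat \<Rightarrow> 'a \<Rightarrow> complex" and I x
    by (induction I rule: infinite_finite_induct) auto
  have "natfun_inverse (C f) i g = natfun_inverse (C h) i g"
  proof (induction i rule: less_induct)
    case (less i)
    show ?case
    proof (cases i)
      case 0
      then show ?thesis using Cg[of 0] by simp
    next
      case (Suc k)
      have "natfun_inverse (C f) (Suc k - j) g = natfun_inverse (C h) (Suc k - j) g"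
        if "j \<in> {1..Suc k}" for j
        by (rule less.IH) (use that Suc in auto)
      then have "(\<Sum>j\<in>{1..Suc k}. fps_nth (C f) j g * natfun_inverse (C f) (Suc k - j) g) =
          (\<Sum>j\<in>{1..Suc k}. fps_nth (C h) j g * natfun_inverse (C h) (Suc k - j) g)"
        by (intro sum.cong refl) (simp only: Cg)
      then show ?thesis
        unfolding Suc fps_right_inverse_constructor.simps times_fun_apply uminus_apply ap
          inverse_fun_apply Cg[of 0] by (rule arg_cong)
    qed
  qed
  then show ?thesis by (simp add: sym_op_def sym_series_def fps_inverse_def C_def)
qed

end

theory Submission
  imports Defs
begin

text \<open>
  On a rotation, and on a reflection, the Adams operations take \<open>\<tau> k\<close> to the power sums
  \<open>x ^ j + y ^ j\<close> of two numbers: \<open>x = \<eta> powi (i * k)\<close>, \<open>y = inverse x\<close>, respectively \<open>x = 1\<close>,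
  \<open>y = -1\<close>. Newton's identities then give \<open>\<lambda>\<^sub>t = (1 + x t) (1 + y t)\<close>, so \<open>\<lambda>\<^sup>2\<close> takes the value
  \<open>x y\<close> there and \<open>S\<^sup>j\<close> the complete homogeneous sum of degree \<open>j\<close> in \<open>x\<close> and \<open>y\<close>.
\<close>

section \<open>Evaluating function-valued power series at a point\<close>

lemma minus_one_power_mult_fun_apply:
  fixes F :: "'g \<Rightarrow> complex"
  shows "((- 1) ^ j * F) g = (- 1) ^ j * F g"
  by (induction j) (simp_all add: mult.assoc)

lemma sum_fun_apply:
  fixes F :: "'i \<Rightarrow> 'g \<Rightarrow> complex"
  shows "sum F I g = (\<Sum>i\<in>I. F i g)"
  by (induction I rule: infinite_finite_induct) auto

text \<open>Evaluation at \<open>g\<close>, applied coefficientwise, is a ring homomorphism; it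
  carries an identity between function-valued series to one over the complex numbers.\<close>

definition fps_eval :: "'g \<Rightarrow> ('g \<Rightarrow> complex) fps \<Rightarrow> complex fps" where
  "fps_eval g F = Abs_fps (\<lambda>n. fps_nth F n g)"

lemma fps_eval_nth [simp]: "fps_nth (fps_eval g F) n = fps_nth F n g"
  by (simp add: fps_eval_def)

lemma fps_eval_mult: "fps_eval g (F * H) = fps_eval g F * fps_eval g H"
  by (rule fps_ext) (simp add: fps_mult_nth sum_fun_apply)

lemma fps_eval_one: "fps_eval g 1 = 1"
  by (rule fps_ext) simp

lemma adams_series_apply:
  "fps_nth (adams_series G f) (Suc j) g = (- 1) ^ Suc j * f (g [^]\<^bsub>G\<^esub> Suc j)"
  by (simp add: adams_series_def minus_one_power_mult_fun_apply adams_def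
      del: times_fun_apply power_Suc)

section \<open>The operations at a point where the Adams operations are power sums\<close>

text \<open>The recursion \<open>lambda_rec\<close> is Newton's identity, here for the elementary
  symmetric functions of two variables, which vanish above degree 2.\<close>

lemma lambda_op_power_sum:
  fixes G :: "('g, 'm) monoid_scheme" and x y :: complex
  assumes f: "\<And>j::nat. j \<ge> 1 \<Longrightarrow> f (g [^]\<^bsub>G\<^esub> j) = x ^ j + y ^ j"
  shows "lambda_op G j f g = (if j = 0 then 1 else if j = 1 then x + y else if j = 2 then x * y else 0)"
proof -
  define p where "p j = (- 1) ^ j * (x ^ j + y ^ j)" for j
  have P: "fps_nth (adams_series G f) (Suc j) g = p (Suc j)" for j
    unfolding adams_series_apply p_def by (subst f) auto
  define e where "e j = lambda_rec (adams_series G f) j g" for j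
  have e0: "e 0 = 1" by (simp add: e_def)
  have eS: "e (Suc m) = - (\<Sum>i\<le>m. p (Suc i) * e (m - i)) / of_nat (Suc m)" for m
    by (simp add: e_def P del: of_nat_Suc)
  have e1: "e 1 = x + y" using eS[of 0] e0 by (simp add: p_def)
  have "e (Suc 1) = x * y"
    unfolding eS[of 1] using e0 e1
    by (simp add: p_def field_simps power2_eq_square)
  then have e2: "e 2 = x * y" by (simp add: numeral_2_eq_2)
  have e3: "e (m + 3) = 0" for m
  proof (induction m rule: less_induct)
    case (less m)
    \<comment> \<open>By induction only the last three terms survive, those with the factors
      \<open>e 2\<close>, \<open>e 1\<close> and \<open>e 0\<close>.\<close>
    have "(\<Sum>i\<le>m + 2. p (Suc i) * e (m + 2 - i)) = (\<Sum>i\<in>{m, m + 1, m + 2}. p (Suc i) * e (m + 2 - i))"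
    proof (rule sum.mono_neutral_right)
      show "\<forall>i\<in>{..m + 2} - {m, m + 1, m + 2}. p (Suc i) * e (m + 2 - i) = 0"
      proof
        fix i assume "i \<in> {..m + 2} - {m, m + 1, m + 2}"
        then have i: "i < m" by auto
        then have "e ((m - i - 1) + 3) = 0" by (intro less.IH) auto
        moreover have "(m - i - 1) + 3 = m + 2 - i" using i by simp
        ultimately show "p (Suc i) * e (m + 2 - i) = 0" by simp
      qed
    qed auto
    also have "\<dots> = p (m + 1) * (x * y) + p (m + 2) * (x + y) + p (m + 3)"
      using e0 e1 e2 by (simp add: numeral_3_eq_3)
    \<comment> \<open>This is the recurrence of the power sums that comes from \<open>x\<close> and
      \<open>y\<close> being the roots of \<open>z^2 - (x + y) z + x y\<close>, with the signs
      absorbed in \<open>p\<close>.\<close>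
    also have "\<dots> = 0" by (simp add: p_def algebra_simps power_add power2_eq_square power3_eq_cube)
    finally show ?case using eS[of "m + 2"] by (simp add: numeral_3_eq_3 del: of_nat_Suc)
  qed
  have "e j = 0" if "j > 2"
    using e3[of "j - 3"] that by simp
  then show ?thesis using e0 e1 e2 unfolding lambda_op_eq e_def[symmetric] by auto
qed

text \<open>At \<open>g\<close> the series to be inverted is \<open>(1 - x t) (1 - y t)\<close>, so
  the inverse is a product of two geometric series.\<close>

lemma sym_op_power_sum:
  fixes G :: "('g, 'm) monoid_scheme" and x y :: complex
  assumes f: "\<And>j::nat. j \<ge> 1 \<Longrightarrow> f (g [^]\<^bsub>G\<^esub> j) = x ^ j + y ^ j"
  shows "sym_op G j f g = (\<Sum>i\<le>j. x ^ i * y ^ (j - i))"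
proof -
  define C where "C = fps_compose (lambda_series G f) (- fps_X)"
  have "C = fps_compose (lambda_series G f) (fps_const (- 1) * fps_X)"
    by (simp add: C_def flip: fps_const_neg)
  then have Cn: "fps_nth C i h = (- 1) ^ i * lambda_op G i f h" for i h
    by (simp add: fps_compose_linear lambda_op_def minus_one_power_mult_fun_apply del: times_fun_apply)
  have geom: "(1 - fps_const z * fps_X) * Abs_fps (\<lambda>i. z ^ i) = 1" for z :: complex
  proof (rule fps_ext)
    fix i show "fps_nth ((1 - fps_const z * fps_X) * Abs_fps (\<lambda>i. z ^ i)) i = fps_nth 1 i"
      by (cases i) (simp_all add: algebra_simps)
  qed
  let ?q = "(1 - fps_const x * fps_X) * (1 - fps_const y * fps_X)"
  let ?h = "Abs_fps (\<lambda>i. x ^ i) * Abs_fps (\<lambda>i. y ^ i)"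
  have q: "?q = 1 - fps_const (x + y) * fps_X + fps_const (x * y) * fps_X ^ 2"
    by (simp add: algebra_simps power2_eq_square flip: fps_const_add fps_const_mult)
  have ev: "fps_eval g C = ?q"
    unfolding q
  proof (rule fps_ext)
    fix i show "fps_nth (fps_eval g C) i =
        fps_nth (1 - fps_const (x + y) * fps_X + fps_const (x * y) * fps_X ^ 2) i"
      by (cases "i = 1") (simp_all add: Cn lambda_op_power_sum[OF f] fps_X_power_nth)
  qed
  \<comment> \<open>The inverse is taken among function-valued series, so the constant term must be
    1 at every point, not only at \<open>g\<close>.\<close>
  have "fps_nth C 0 = 1"
    by (simp add: fun_eq_iff Cn lambda_op_eq)
  then have "fps_eval g (C * inverse C) = 1"
    by (simp only: fps_fun_inverse fps_eval_one)
  then have "?q * fps_eval g (inverse C) = 1" by (simp only: fps_eval_mult ev)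
  moreover have "?q * ?h = 1"
  proof -
    have "?q * ?h = ((1 - fps_const x * fps_X) * Abs_fps (\<lambda>i. x ^ i)) *
        ((1 - fps_const y * fps_X) * Abs_fps (\<lambda>i. y ^ i))" by (simp only: mult_ac)
    then show ?thesis by (simp only: geom mult_1)
  qed
  \<comment> \<open>Both series are inverses of \<open>?q\<close>, and inverses in a commutative
    ring are unique.\<close>
  ultimately have "fps_eval g (inverse C) = ?h"
    using mult.left_commute[of ?h ?q "fps_eval g (inverse C)"]
    by (simp only: mult_1_right mult.assoc[symmetric] mult_1)
  then have "fps_nth (inverse C) j g = fps_nth ?h j" by (metis fps_eval_nth)
  then show ?thesis
    by (simp add: sym_op_def sym_series_def C_def fps_mult_nth atLeast0AtMost)
qed

text \<open>All terms except the two pure powers contain the factor \<open>x * y\<close>.\<close>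

lemma complete_sum_step:
  fixes x y :: "'a::comm_semiring_1"
  shows "(\<Sum>i\<le>Suc (Suc j). x ^ i * y ^ (Suc (Suc j) - i)) =
    x * y * (\<Sum>i\<le>j. x ^ i * y ^ (j - i)) + (x ^ Suc (Suc j) + y ^ Suc (Suc j))"
proof -
  have "(\<Sum>i\<le>Suc (Suc j). x ^ i * y ^ (Suc (Suc j) - i)) =
      y ^ Suc (Suc j) + (\<Sum>i\<le>Suc j. x ^ Suc i * y ^ (Suc j - i))"
    by (subst sum.atMost_Suc_shift) (simp only: power_0 mult_1 diff_zero diff_Suc_Suc)
  also have "(\<Sum>i\<le>Suc j. x ^ Suc i * y ^ (Suc j - i)) =
      (\<Sum>i\<le>j. x * y * (x ^ i * y ^ (j - i))) + x ^ Suc (Suc j)"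
    by (simp add: Suc_diff_le mult_ac)
  finally show ?thesis by (simp add: sum_distrib_left ac_simps)
qed

text \<open>With \<open>x * y = 1\<close> each step of two degrees adds one pair of powers. The
  final 1 is the sum of degree 0 and becomes the summand \<open>\<chi>1\<close>.\<close>

lemma complete_sum_even:
  fixes x y :: "'a::comm_semiring_1"
  assumes "x * y = 1"
  shows "(\<Sum>i\<le>2 * m. x ^ i * y ^ (2 * m - i)) = (\<Sum>i=1..m. x ^ (2 * i) + y ^ (2 * i)) + 1"
proof (induction m)
  case (Suc m)
  have "2 * Suc m = Suc (Suc (2 * m))" by simp
  then show ?case
    by (simp only: complete_sum_step Suc assms mult_1) (simp add: add.assoc add.commute)
qed simp

lemma complete_sum_odd:
  fixes x y :: "'a::comm_semiring_1"
  assumes "x * y = 1"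
  shows "(\<Sum>i\<le>2 * m + 1. x ^ i * y ^ (2 * m + 1 - i)) =
    (\<Sum>i=1..m + 1. x ^ (2 * i - 1) + y ^ (2 * i - 1))"
proof (induction m)
  case (Suc m)
  have "2 * Suc m + 1 = Suc (Suc (2 * m + 1))" by simp
  then show ?case
    by (simp only: complete_sum_step Suc assms mult_1) simp
qed (simp add: add.commute)

text \<open>For \<open>x * y = -1\<close> each step negates the sum and adds 2 or 0, according to
  parity.\<close>

lemma complete_sum_one_minus_one:
  "(\<Sum>i\<le>j. 1 ^ i * (- 1) ^ (j - i)) = (if even j then 1 else 0 :: 'a::comm_ring_1)"
proof (induction j rule: induct_nat_012)
  case (ge2 j)
  then show ?case by (simp only: complete_sum_step) simp
qed simp_all

section \<open>Normal forms and powers in the dihedral group\<close>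

context dihedral_group
begin

lemma rotation_swap: "a [^] (i::nat) \<otimes> b = b \<otimes> inv (a [^] i)"
proof -
  have [simp]: "a \<in> carrier G" "b \<in> carrier G" by (fact a_closed b_closed)+
  have bb: "b \<otimes> b = \<one>" using b_pow by (simp add: numeral_2_eq_2)
  then have ib: "inv b = b" by (simp add: inv_equality)
  \<comment> \<open>Inserting \<open>b \<otimes> b\<close> in front exposes the conjugate of
    \<open>a\<close> by \<open>b\<close>.\<close>
  have "a \<otimes> b = (b \<otimes> b) \<otimes> (a \<otimes> b)" by (simp add: bb)
  also have "\<dots> = b \<otimes> (b \<otimes> a \<otimes> inv b)" by (simp only: ib) (simp add: m_assoc)
  finally have ab: "a \<otimes> b = b \<otimes> inv a" by (simp only: conj)
  show ?thesis
  proof (induction i)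
    case (Suc i)
    have "a [^] Suc i \<otimes> b = a [^] i \<otimes> (b \<otimes> inv a)" by (simp add: m_assoc ab)
    also have "\<dots> = b \<otimes> (inv (a [^] i) \<otimes> inv a)" by (simp add: Suc flip: m_assoc)
    also have "\<dots> = b \<otimes> inv (a [^] Suc i)"
      by (simp only: inv_mult_group nat_pow_Suc2 nat_pow_closed \<open>a \<in> carrier G\<close>)
    finally show ?case .
  qed simp
qed

lemma rotation_mod: "a [^] (i::nat) = a [^] (i mod n)"
proof -
  have "a [^] (n * (i div n) + i mod n) = (a [^] n) [^] (i div n) \<otimes> a [^] (i mod n)"
    using a_closed by (simp only: nat_pow_mult nat_pow_pow)
  also have "\<dots> = a [^] (i mod n)" using a_closed by (simp add: a_pow)
  finally show ?thesis by simp
qed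

text \<open>Writing inverses as natural powers keeps all normal forms in natural exponents; the
  witness works because \<open>i * (n - 1) + i = n * i\<close>.\<close>

lemma inv_rotation:
  assumes "n > 0"
  obtains j :: nat where "inv (a [^] (i::nat)) = a [^] j"
proof
  have "a [^] (i * (n - 1)) \<otimes> a [^] i = a [^] (n * i)"
    using a_closed assms by (simp add: nat_pow_mult algebra_simps)
  also have "\<dots> = \<one>" using a_closed by (simp add: nat_pow_pow[symmetric] a_pow)
  finally show "inv (a [^] i) = a [^] (i * (n - 1))"
    using a_closed by (simp add: inv_equality)
qed

text \<open>Moving the second \<open>b\<close> to the left inverts the rotation before it, which
  then cancels against the last factor.\<close>

lemma reflection_square: "(b \<otimes> a [^] (i::nat)) \<otimes> (b \<otimes> a [^] i) = \<one>"
proof -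
  have [simp]: "a \<in> carrier G" "b \<in> carrier G" by (fact a_closed b_closed)+
  have bb: "b \<otimes> b = \<one>" using b_pow by (simp add: numeral_2_eq_2)
  have "(b \<otimes> a [^] i) \<otimes> (b \<otimes> a [^] i) = b \<otimes> ((a [^] i \<otimes> b) \<otimes> a [^] i)"
    by (simp add: m_assoc)
  also have "\<dots> = (b \<otimes> b) \<otimes> (inv (a [^] i) \<otimes> a [^] i)" by (simp add: rotation_swap m_assoc)
  finally show ?thesis by (simp add: bb)
qed

lemma reflection_pow: "(b \<otimes> a [^] (i::nat)) [^] (j::nat) = (if even j then \<one> else b \<otimes> a [^] i)"
  using a_closed b_closed reflection_square[of i] by (induction j) auto

text \<open>The elements of these two shapes include the identity, the generators and their
  inverses, and are closed under products; exponents are reduced modulo \<open>n\<close> at the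
  end.\<close>

lemma carrier_cases:
  assumes n: "n > 0" and "g \<in> carrier G"
  obtains i where "i < n" "g = a [^] i" | i where "i < n" "g = b \<otimes> a [^] i"
proof -
  have [simp]: "a \<in> carrier G" "b \<in> carrier G" by (fact a_closed b_closed)+
  have bb: "b \<otimes> b = \<one>" using b_pow by (simp add: numeral_2_eq_2)
  have rr: "a [^] (i::nat) \<otimes> a [^] (j::nat) = a [^] (i + j)" for i j by (simp add: nat_pow_mult)
  have "\<exists>i::nat. g = a [^] i \<or> g = b \<otimes> a [^] i"
    using assms(2) unfolding generated
  proof (induction g rule: generate.induct)
    case one
    have "\<one> = a [^] (0::nat)" by simp
    then show ?case by blast
  next
    case (incl h)
    have "a = a [^] (1::nat)" "b = b \<otimes> a [^] (0::nat)" by simp_all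
    with incl show ?case by blast
  next
    case (inv h)
    have "inv b = b \<otimes> a [^] (0::nat)" using bb by (simp add: inv_equality)
    moreover have a1: "a [^] (1::nat) = a" by simp
    moreover obtain j :: nat where "inv (a [^] (1::nat)) = a [^] j" using inv_rotation[OF n] .
    ultimately show ?case using inv by (metis insertE a1 singletonD)
  next
    case (eng h1 h2)
    then obtain i j :: nat where h1: "h1 = a [^] i \<or> h1 = b \<otimes> a [^] i"
      and h2: "h2 = a [^] j \<or> h2 = b \<otimes> a [^] j" by blast
    obtain l :: nat where l: "inv (a [^] i) = a [^] l" using inv_rotation[OF n] .
    \<comment> \<open>This is the product that requires reordering; the other three follow from it
      or from adding exponents.\<close>
    have s: "a [^] i \<otimes> (b \<otimes> a [^] j) = b \<otimes> a [^] (l + j)"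
    proof -
      have "a [^] i \<otimes> (b \<otimes> a [^] j) = (a [^] i \<otimes> b) \<otimes> a [^] j" by (simp add: m_assoc)
      also have "\<dots> = b \<otimes> a [^] (l + j)" by (simp only: rotation_swap l) (simp add: m_assoc rr)
      finally show ?thesis .
    qed
    have "(b \<otimes> a [^] i) \<otimes> (b \<otimes> a [^] j) = (b \<otimes> b) \<otimes> a [^] (l + j)"
      by (simp add: m_assoc s)
    then have "(b \<otimes> a [^] i) \<otimes> (b \<otimes> a [^] j) = a [^] (l + j)" by (simp add: bb)
    moreover have "(b \<otimes> a [^] i) \<otimes> a [^] j = b \<otimes> a [^] (i + j)" by (simp add: m_assoc rr)
    ultimately show ?case using h1 h2 s rr by metis
  qed
  then obtain i :: nat where "g = a [^] i \<or> g = b \<otimes> a [^] i" ..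
  then have "g = a [^] (i mod n) \<or> g = b \<otimes> a [^] (i mod n)" by (metis rotation_mod)
  moreover have "i mod n < n" using n by simp
  ultimately show thesis using that by blast
qed

end

section \<open>Evaluation on rotations and reflections\<close>

theorem proposition6p6p1:
  fixes G :: "('g, 'm) monoid_scheme" (structure)
    and n :: nat and a b :: 'g and \<eta> :: complex
    and \<tau> :: "int \<Rightarrow> 'g \<Rightarrow> complex" and \<chi>1 \<chi>2 :: "'g \<Rightarrow> complex"
  assumes n: "n \<ge> 1"
    and dihedral: "dihedral_group G n a b"
    and eta: "primitive_root_unity n \<eta>"
    and tau_rot: "\<And>k i. i < n \<Longrightarrow>
          \<tau> k (a [^] i) = \<eta> powi (int i * k) + \<eta> powi (- (int i * k))"
    and tau_refl: "\<And>k i. i < n \<Longrightarrow> \<tau> k (b \<otimes> a [^] i) = 0"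
    and chi1: "\<And>g. g \<in> carrier G \<Longrightarrow> \<chi>1 g = 1"
    and chi2_rot: "\<And>i::nat. \<chi>2 (a [^] i) = 1"
    and chi2_refl: "\<And>i::nat. \<chi>2 (b \<otimes> a [^] i) = - 1"
  shows "\<forall>k::int.
    (\<forall>g\<in>carrier G. lambda_op G 2 (\<tau> k) g = \<chi>2 g) \<and>
    (\<forall>m::nat. m \<ge> 1 \<longrightarrow>
      (\<forall>g\<in>carrier G.
        sym_op G (2 * m - 1) (\<tau> k) g = (\<Sum>i=1..m. \<tau> ((2 * int i - 1) * k) g) \<and>
        sym_op G (2 * m) (\<tau> k) g = (\<Sum>i=1..m. \<tau> (2 * int i * k) g) + \<chi>1 g))"
proof (intro allI)
  fix k :: int
  interpret dihedral_group G n a b by (fact dihedral)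
  have n0: "n > 0" using n by simp
  have \<eta>n: "\<eta> ^ n = 1" using eta by (simp add: primitive_root_unity_def)
  then have \<eta>0: "\<eta> \<noteq> 0" using n0 by (auto simp: power_0_left)
  have \<eta>mod: "\<eta> powi (int (i mod n) * q) = \<eta> powi (int i * q)" for i q
  proof -
    have "\<eta> ^ (n * (i div n) + i mod n) = \<eta> ^ (i mod n)"
      by (simp only: power_add power_mult \<eta>n) simp
    then have "\<eta> ^ i = \<eta> ^ (i mod n)" by simp
    then show ?thesis by (simp add: power_int_mult)
  qed
  have rot: "\<tau> q (a [^] i) = \<eta> powi (int i * q) + \<eta> powi (- (int i * q))" for q and i :: nat
  proof -
    have "\<tau> q (a [^] i) = \<tau> q (a [^] (i mod n))" by (metis rotation_mod)
    \<comment> \<open>The sign is moved onto \<open>q\<close> so that \<open>\<eta>mod\<close>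
      reduces both summands.\<close>
    also have "\<dots> = \<eta> powi (int (i mod n) * q) + \<eta> powi (int (i mod n) * - q)"
      using tau_rot[of "i mod n" q] n0 by simp
    finally show ?thesis by (simp only: \<eta>mod) simp
  qed
  have one: "\<tau> q \<one> = 2" for q using rot[of q 0] by simp
  let ?claim = "\<lambda>g. lambda_op G 2 (\<tau> k) g = \<chi>2 g \<and> (\<forall>m::nat. m \<ge> 1 \<longrightarrow>
        sym_op G (2 * m - 1) (\<tau> k) g = (\<Sum>i=1..m. \<tau> ((2 * int i - 1) * k) g) \<and>
        sym_op G (2 * m) (\<tau> k) g = (\<Sum>i=1..m. \<tau> (2 * int i * k) g) + \<chi>1 g)"
  have "?claim g" if g: "g \<in> carrier G" for g
    using n0 g
  proof (cases rule: carrier_cases)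
    case (1 i)
    define x where "x = \<eta> powi (int i * k)"
    define y where "y = \<eta> powi (- (int i * k))"
    have xy: "x * y = 1" using \<eta>0 by (simp add: x_def y_def power_int_minus)
    \<comment> \<open>On rotations the \<open>q\<close>-th Adams operation takes
      \<open>\<tau> k\<close> to \<open>\<tau> (q k)\<close>; hence power sums of \<open>x\<close>
      and \<open>y\<close> are values of the functions in the claim.\<close>
    have \<tau>: "\<tau> (int q * k) g = x ^ q + y ^ q" for q
    proof -
      have "\<eta> powi (int i * (int q * k)) = x ^ q" "\<eta> powi (- (int i * (int q * k))) = y ^ q"
        by (simp_all add: x_def y_def mult_ac flip: power_int_mult power_int_of_nat)
      then show ?thesis by (simp add: 1 rot)
    qed
    have P: "\<tau> k (g [^] j) = x ^ j + y ^ j" for j :: nat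
    proof -
      have "\<tau> k (g [^] j) = \<tau> (int j * k) g"
        using a_closed by (simp add: 1 nat_pow_pow rot mult_ac)
      then show ?thesis by (simp only: \<tau>)
    qed
    have "sym_op G (2 * m - 1) (\<tau> k) g = (\<Sum>i=1..m. \<tau> ((2 * int i - 1) * k) g)"
      if "m \<ge> 1" for m
    proof -
      obtain l where m: "m = l + 1" using \<open>m \<ge> 1\<close> by (metis add.commute le_Suc_ex)
      have "sym_op G (2 * m - 1) (\<tau> k) g = (\<Sum>i=1..m. x ^ (2 * i - 1) + y ^ (2 * i - 1))"
        using complete_sum_odd[OF xy, of l] by (simp add: sym_op_power_sum[OF P] m)
      also have "\<dots> = (\<Sum>i=1..m. \<tau> ((2 * int i - 1) * k) g)"
      proof (rule sum.cong)
        fix i assume "i \<in> {1..m}"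
        \<comment> \<open>The bound \<open>i \<ge> 1\<close> makes the natural subtraction
          exact.\<close>
        then have "int (2 * i - 1) = 2 * int i - 1" by auto
        then show "x ^ (2 * i - 1) + y ^ (2 * i - 1) = \<tau> ((2 * int i - 1) * k) g"
          using \<tau>[of "2 * i - 1"] by simp
      qed simp
      finally show ?thesis .
    qed
    moreover have "sym_op G (2 * m) (\<tau> k) g = (\<Sum>i=1..m. \<tau> (2 * int i * k) g) + \<chi>1 g" for m
    proof -
      have "\<tau> (2 * int i * k) g = x ^ (2 * i) + y ^ (2 * i)" for i using \<tau>[of "2 * i"] by simp
      then show ?thesis
        using complete_sum_even[OF xy, of m] chi1[OF g] by (simp add: sym_op_power_sum[OF P])
    qed
    moreover have "lambda_op G 2 (\<tau> k) g = x * y" by (simp add: lambda_op_power_sum[OF P])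
    then have "lambda_op G 2 (\<tau> k) g = \<chi>2 g" using xy 1 chi2_rot by simp
    ultimately show ?thesis by blast
  next
    case (2 i)
    \<comment> \<open>Even powers of a reflection are the identity, with value
      \<open>2 = 1 + 1\<close>; odd powers are the reflection itself, with value
      \<open>0 = 1 - 1\<close>.\<close>
    have P: "\<tau> k (g [^] j) = 1 ^ j + (- 1) ^ j" for j :: nat
      by (simp add: 2 reflection_pow one tau_refl)
    have "lambda_op G 2 (\<tau> k) g = - 1" by (simp add: lambda_op_power_sum[OF P])
    then have "lambda_op G 2 (\<tau> k) g = \<chi>2 g" using 2 chi2_refl by simp
    \<comment> \<open>Only \<open>\<chi>1\<close> contributes on the right, which matches the parity
      pattern 0, 1 of the complete sums.\<close>
    moreover have "\<tau> q g = 0" for q by (simp add: 2 tau_refl)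
    ultimately show ?thesis
      using chi1[OF g] by (simp only: sym_op_power_sum[OF P] complete_sum_one_minus_one) auto
  qed
  then show "(\<forall>g\<in>carrier G. lambda_op G 2 (\<tau> k) g = \<chi>2 g) \<and>
    (\<forall>m::nat. m \<ge> 1 \<longrightarrow>
      (\<forall>g\<in>carrier G.
        sym_op G (2 * m - 1) (\<tau> k) g = (\<Sum>i=1..m. \<tau> ((2 * int i - 1) * k) g) \<and>
        sym_op G (2 * m) (\<tau> k) g = (\<Sum>i=1..m. \<tau> (2 * int i * k) g) + \<chi>1 g))"
    by blast
qed

end
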